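(* Let $(g^{(n)},B^{(n)})_{n\ge 1}$ be a sequence of stochastic block models, where for each $n$ the model has $n$ nodes and $K^{(n)}$ communities, $g^{(n)}\in\{1,\dots,K^{(n)}\}^n$ and $B^{(n)}\in\mathcal B_{K^{(n)}}$. Assume there exists $c_0>0$ such that $\min_{1\le k\le K^{(n)}}|\{i:g^{(n)}_i=k\}|\ge c_0 n/K^{(n)}$ for all $n$. For each $n$ let $A$ be an adjacency matrix generated from $(g^{(n)},B^{(n)})$, and let $\delta_n$ be the smallest $\ell_\infty$ distance among all pairs of distinct rows of $B^{(n)}$. Then for any hypothetical number of communities $K_0$ (a positive integer, possibly depending on $n$) with $K_0<K^{(n)}$ and any community estimator $\hat g$ with values in $\{1,\dots,K_0\}^n$, the empirically centered and rescaled adjacency matrix $\tilde A$ built from $\hat g$ and the corresponding plug-in estimate $\hat B$ satisfies, as $n\to\infty$, $$\sigma_1(\tilde A)\ \ge\ \tfrac12\,\delta_n\,c_0\,[K^{(n)}]^{-2}\,n^{1/2}+O_P(1).$$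
   Context: $\mathcal B_K$ is the set of all symmetric $K\times K$ matrices with entries in $(0,1)$ whose rows are pairwise distinct. Stochastic block model $(g,B)$ with $g\in\{1,\dots,K\}^n$ and $B\in[0,1]^{K\times K}$ symmetric: the adjacency matrix $A$ is a random symmetric binary $n\times n$ matrix with zero diagonal whose entries $A_{ij}$, $i<j$, are independent Bernoulli with parameter $B_{g_ig_j}$. A community estimator with target number $K_0$ is a function $\hat g=\hat g(A,K_0)\in\{1,\dots,K_0\}^n$ of the data. Given $\hat g$, let $\hat{\mathcal N}_k=\{i:\hat g_i=k\}$ and $\hat n_k=|\hat{\mathcal N}_k|$. The plug-in estimate is $\hat B_{kl}=\frac{1}{\hat n_k\hat n_l}\sum_{i\in\hat{\mathcal N}_k,\,j\in\hat{\mathcal N}_l}A_{ij}$ for $k\ne l$ and $\hat B_{kk}=\frac{2}{\hat n_k(\hat n_k-1)}\sum_{i,j\in\hat{\mathcal N}_k,\,i<j}A_{ij}$. Put $\hat P_{ij}=\hat B_{\hat g_i\hat g_j}$. The matrix $\tilde A$ is defined by $\tilde A_{ii}=0$ and $\tilde A_{ij}=\frac{A_{ij}-\hat P_{ij}}{\sqrt{(n-1)\hat P_{ij}(1-\hat P_{ij})}}$ for $i\neq j$, with the convention $0/0=0$ (if $\hat P_{ij}\in\{0,1\}$ for some $i\ne j$ then $A_{ij}=\hat P_{ij}$). $\sigma_1(M)$ denotes the largest singular value of $M$. The inequality with $O_P(1)$ means: there is a sequence of random variables $R_n=O_P(1)$ (bounded in probability) such that $\sigma_1(\tilde A)\ge\frac12\delta_nc_0[K^{(n)}]^{-2}n^{1/2}+R_n$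 for all $n$. *)

theory Defs
  imports "HOL-Probability.Probability" "Jordan_Normal_Form.Spectral_Radius"
begin

(* Nodes and community labels are counted from 0, in line with the matrix indices:
   a labelling g in {1..K}^n is a function nat => nat restricted to {..<n} with values
   in {..<K}. *)

definition labelling :: "nat \<Rightarrow> nat \<Rightarrow> (nat \<Rightarrow> nat) \<Rightarrow> bool" where
  "labelling n K g \<longleftrightarrow> g \<in> {..<n} \<rightarrow> {..<K}"

definition community :: "nat \<Rightarrow> (nat \<Rightarrow> nat) \<Rightarrow> nat \<Rightarrow> nat set" where
  "community n g k = {i. i < n \<and> g i = k}"

definition adjacency_matrices :: "nat \<Rightarrow> real mat set" where
  "adjacency_matrices n =
     {A \<in> carrier_mat n n. transpose_mat A = A
        \<and> (\<forall>i<n. \<forall>j<n. A $$ (i, j) \<in> {0, 1}) \<and> (\<forall>i<n. A $$ (i, i) = 0)}"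

definition connectivity_matrices :: "nat \<Rightarrow> real mat set" where
  "connectivity_matrices K =
     {B \<in> carrier_mat K K. transpose_mat B = B
        \<and> (\<forall>k<K. \<forall>l<K. 0 < B $$ (k, l) \<and> B $$ (k, l) < 1)
        \<and> (\<forall>k<K. \<forall>l<K. k \<noteq> l \<longrightarrow> Matrix.row B k \<noteq> Matrix.row B l)}"

definition linf_dist :: "real Matrix.vec \<Rightarrow> real Matrix.vec \<Rightarrow> real" where
  "linf_dist u v = Max ((\<lambda>j. \<bar>vec_index u j - vec_index v j\<bar>) ` {..<dim_vec u})"

(* Only meaningful for at least two rows. *)
definition min_row_dist :: "real mat \<Rightarrow> real" where
  "min_row_dist B = Min {linf_dist (Matrix.row B k) (Matrix.row B l) | k l.
     k < dim_row B \<and> l < dim_row B \<and> k \<noteq> l}"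

(* A is the adjacency matrix of the stochastic block model (g, B) with n nodes and K
   communities, as a random matrix on the probability space M.  The entries are 0/1-valued,
   so the probability of the value 1 determines the Bernoulli law. *)
definition stochastic_block_model ::
  "'a measure \<Rightarrow> nat \<Rightarrow> nat \<Rightarrow> (nat \<Rightarrow> nat) \<Rightarrow> real mat \<Rightarrow> ('a \<Rightarrow> real mat) \<Rightarrow> bool" where
  "stochastic_block_model M n K g B A \<longleftrightarrow>
     prob_space M
     \<and> labelling n K g
     \<and> B \<in> carrier_mat K K \<and> transpose_mat B = B
     \<and> (\<forall>k<K. \<forall>l<K. 0 \<le> B $$ (k, l) \<and> B $$ (k, l) \<le> 1)
     \<and> (\<forall>\<omega>\<in>space M. A \<omega> \<in> adjacency_matrices n)
     \<and> prob_space.indep_vars M (\<lambda>_. borel) (\<lambda>(i, j) \<omega>. A \<omega> $$ (i, j)) {(i, j). i < j \<and> j < n}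
     \<and> (\<forall>i j. i < j \<and> j < n \<longrightarrow>
          measure M {\<omega>\<in>space M. A \<omega> $$ (i, j) = 1} = B $$ (g i, g j))"

definition community_estimator ::
  "nat \<Rightarrow> nat \<Rightarrow> (real mat \<Rightarrow> nat \<Rightarrow> nat \<Rightarrow> nat) \<Rightarrow> bool" where
  "community_estimator n K0 ghat \<longleftrightarrow> (\<forall>A\<in>adjacency_matrices n. labelling n K0 (ghat A K0))"

definition plugin_B :: "nat \<Rightarrow> nat \<Rightarrow> real mat \<Rightarrow> (nat \<Rightarrow> nat) \<Rightarrow> real mat" where
  "plugin_B n K0 A h = Matrix.mat K0 K0 (\<lambda>(k, l).
     let N = community n h; m = (\<lambda>k. real (card (N k))) in
     if k \<noteq> l then 1 / (m k * m l) * (\<Sum>i\<in>N k. \<Sum>j\<in>N l. A $$ (i, j))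
     else 2 / (m k * (m k - 1)) * (\<Sum>(i, j)\<in>{(i, j). i \<in> N k \<and> j \<in> N k \<and> i < j}. A $$ (i, j)))"

definition plugin_P :: "nat \<Rightarrow> nat \<Rightarrow> real mat \<Rightarrow> (nat \<Rightarrow> nat) \<Rightarrow> real mat" where
  "plugin_P n K0 A h = Matrix.mat n n (\<lambda>(i, j). plugin_B n K0 A h $$ (h i, h j))"

(* The convention 0/0 = 0 is the HOL convention x/0 = 0. *)
definition rescaled_adjacency :: "nat \<Rightarrow> nat \<Rightarrow> real mat \<Rightarrow> (nat \<Rightarrow> nat) \<Rightarrow> real mat" where
  "rescaled_adjacency n K0 A h = Matrix.mat n n (\<lambda>(i, j).
     let P = plugin_P n K0 A h in
     if i = j then 0
     else (A $$ (i, j) - P $$ (i, j))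
            / sqrt (real (n - 1) * P $$ (i, j) * (1 - P $$ (i, j))))"

definition singular_values :: "real mat \<Rightarrow> real set" where
  "singular_values M = sqrt ` spectrum (transpose_mat M * M)"

definition largest_singular_value :: "real mat \<Rightarrow> real" where
  "largest_singular_value M = Max (singular_values M)"

definition O_P_1 :: "(nat \<Rightarrow> 'a measure) \<Rightarrow> (nat \<Rightarrow> 'a \<Rightarrow> real) \<Rightarrow> bool" where
  "O_P_1 M R \<longleftrightarrow>
     (\<forall>n\<ge>1. R n \<in> borel_measurable (M n))
     \<and> (\<forall>\<epsilon>>0. \<exists>C. \<forall>n\<ge>1. measure (M n) {\<omega>\<in>space (M n). \<bar>R n \<omega>\<bar> > C} \<le> \<epsilon>)"

end

theory Submission
  imports Defs
begin

text \<open>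
  Each true community meets some estimated community in at least a \<open>1/K\<^sub>0\<close> fraction of its nodes,
  and by the pigeonhole principle two true communities \<open>k\<^sub>1 \<noteq> k\<^sub>2\<close> do so with the same estimated
  community. Choose \<open>l\<close> with \<open>\<bar>B k\<^sub>1 l - B k\<^sub>2 l\<bar> \<ge> \<delta>\<close>. On the corresponding two blocks \<open>I \<times> J\<close>, with
  \<open>card I\<close> and \<open>card J\<close> at least \<open>c\<^sub>0 n / K\<^sup>2\<close>, the plug-in estimate is one constant \<open>p\<close>, so on one of
  them the true mean differs from \<open>p\<close> by at least \<open>\<delta>/2\<close>. Testing the rescaled matrix against the
  indicator vectors of \<open>I\<close> and \<open>J\<close>, and using \<open>p (1 - p) \<le> 1/4\<close>, bounds its largest singular value
  from below by \<open>\<delta> c\<^sub>0 n\<^sup>1\<^sup>/\<^sup>2 / K\<^sup>2\<close> up to the noise on the block. Hoeffding's inequality and a union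
  bound over all \<open>4\<^sup>n\<close> pairs \<open>(I, J)\<close> make the noise bounded in probability, whatever the estimator.
\<close>

unbundle no inner_syntax and no vec_syntax

section \<open>Rayleigh quotients and the largest singular value\<close>

lemma symmetric_mat_index:
  assumes "S \<in> carrier_mat n n" "transpose_mat S = S" "i < n" "j < n"
  shows "S $$ (j, i) = S $$ (i, j)"
  using assms by (metis carrier_matD index_transpose_mat(1))

lemma scalar_prod_self_ge_0: "0 \<le> (x :: real Matrix.vec) \<bullet> x"
  unfolding scalar_prod_def by (intro sum_nonneg) auto

lemma scalar_prod_self_eq_0_iff:
  fixes x :: "real Matrix.vec"
  assumes "x \<in> carrier_vec n"
  shows "x \<bullet> x = 0 \<longleftrightarrow> x = 0\<^sub>v n"
  using assms by (auto simp: scalar_prod_def sum_nonneg_eq_0_iff intro!: eq_vecI)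

text \<open>Every product \<open>x_i * x_j\<close> is at most \<open>x \<bullet> x\<close> in
  absolute value, so the sum of the absolute entries works as a constant. This crude bound suffices:
  it only has to make Rayleigh quotients bounded above.\<close>

lemma quadratic_form_bound:
  fixes S :: "real mat"
  assumes S: "S \<in> carrier_mat n n"
  obtains c where "0 < c" "\<And>x. x \<in> carrier_vec n \<Longrightarrow> x \<bullet> (S *\<^sub>v x) \<le> c * (x \<bullet> x)"
proof
  \<comment> \<open>The summand 1 keeps the constant positive even when \<open>S\<close>
    vanishes.\<close>
  let ?c = "1 + (\<Sum>i<n. \<Sum>j<n. \<bar>S $$ (i, j)\<bar>)"
  show "0 < ?c"
    by (intro add_pos_nonneg sum_nonneg) auto
  fix x :: "real Matrix.vec" assume x: "x \<in> carrier_vec n"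
  have coord: "(x $ i)\<^sup>2 \<le> x \<bullet> x" if "i < n" for i
  proof -
    have "(x $ i)\<^sup>2 = (\<Sum>k\<in>{i}. x $ k * x $ k)"
      by (simp add: power2_eq_square)
    also have "\<dots> \<le> (\<Sum>k\<in>{0..<n}. x $ k * x $ k)"
      using that by (intro sum_mono2) auto
    finally show ?thesis using x by (simp add: scalar_prod_def)
  qed
  have entry: "x $ i * (S $$ (i, j) * x $ j) \<le> \<bar>S $$ (i, j)\<bar> * (x \<bullet> x)" if "i < n" "j < n" for i j
  proof -
    have "2 * \<bar>x $ i * x $ j\<bar> \<le> (x $ i)\<^sup>2 + (x $ j)\<^sup>2"
      using sum_squares_bound[of "\<bar>x $ i\<bar>" "\<bar>x $ j\<bar>"] by (simp add: abs_mult)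
    then have *: "\<bar>x $ i * x $ j\<bar> \<le> x \<bullet> x"
      using coord[OF that(1)] coord[OF that(2)] by linarith
    have "x $ i * (S $$ (i, j) * x $ j) \<le> \<bar>S $$ (i, j)\<bar> * \<bar>x $ i * x $ j\<bar>"
      using abs_ge_self[of "x $ i * (S $$ (i, j) * x $ j)"] by (simp add: abs_mult ac_simps)
    also have "\<dots> \<le> \<bar>S $$ (i, j)\<bar> * (x \<bullet> x)"
      using * by (intro mult_left_mono) auto
    finally show ?thesis .
  qed
  have "x \<bullet> (S *\<^sub>v x) = (\<Sum>i<n. \<Sum>j<n. x $ i * (S $$ (i, j) * x $ j))"
    using S x by (simp add: scalar_prod_def atLeast0LessThan sum_distrib_left)
  also have "\<dots> \<le> (\<Sum>i<n. \<Sum>j<n. \<bar>S $$ (i, j)\<bar> * (x \<bullet> x))"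
    using entry by (intro sum_mono) auto
  also have "\<dots> \<le> ?c * (x \<bullet> x)"
    using scalar_prod_self_ge_0[of x] by (simp add: sum_distrib_right distrib_right)
  finally show "x \<bullet> (S *\<^sub>v x) \<le> ?c * (x \<bullet> x)" .
qed

lemma det_nonzero_inverse:
  fixes T :: "real mat"
  assumes T: "T \<in> carrier_mat n n" and "det T \<noteq> 0"
  obtains N where "N \<in> carrier_mat n n" "N * T = 1\<^sub>m n"
  using det_non_zero_imp_unit[OF assms, of "()"]
  by (auto simp: Units_def ring_mat_def)

text \<open>Two estimates are chained through \<open>y = T x\<close>. Invertibility gives
  \<open>x \<bullet> x \<le> a * (y \<bullet> y)\<close>, where \<open>a\<close> bounds the form of
  \<open>N^T N\<close> for the inverse \<open>N\<close>. Semidefiniteness gives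
  \<open>y \<bullet> y \<le> c * (x \<bullet> y)\<close>, where \<open>c\<close> bounds the form of
  \<open>T\<close>. Hence \<open>d = 1 / (a * c)\<close>.\<close>

lemma psd_nonsingular_coercive:
  fixes T :: "real mat"
  assumes T: "T \<in> carrier_mat n n" and sym: "transpose_mat T = T"
    and psd: "\<And>x. x \<in> carrier_vec n \<Longrightarrow> 0 \<le> x \<bullet> (T *\<^sub>v x)"
    and det: "det T \<noteq> 0"
  obtains d where "0 < d" "\<And>x. x \<in> carrier_vec n \<Longrightarrow> d * (x \<bullet> x) \<le> x \<bullet> (T *\<^sub>v x)"
proof -
  obtain N where N: "N \<in> carrier_mat n n" and NT: "N * T = 1\<^sub>m n"
    using det_nonzero_inverse[OF T det] .
  have NN: "transpose_mat N * N \<in> carrier_mat n n"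
    using N by simp
  obtain a where a: "0 < a" "\<And>y. y \<in> carrier_vec n \<Longrightarrow> y \<bullet> (transpose_mat N * N *\<^sub>v y) \<le> a * (y \<bullet> y)"
    using quadratic_form_bound[OF NN] by metis
  obtain c where c: "0 < c" "\<And>y. y \<in> carrier_vec n \<Longrightarrow> y \<bullet> (T *\<^sub>v y) \<le> c * (y \<bullet> y)"
    using quadratic_form_bound[OF T] by metis
  show ?thesis
  proof
    show "0 < 1 / (a * c)" using a c by simp
    fix x :: "real Matrix.vec" assume x: "x \<in> carrier_vec n"
    define y where "y = T *\<^sub>v x"
    have y: "y \<in> carrier_vec n" using T x by (simp add: y_def)
    have Ty: "T *\<^sub>v y \<in> carrier_vec n" using T y by simp
    have "N *\<^sub>v y = x"
      unfolding y_def using N T x NT by (metis assoc_mult_mat_vec one_mult_mat_vec)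
    then have "x \<bullet> x = (N *\<^sub>v y) \<bullet> (N *\<^sub>v y)" by simp
    also have "\<dots> = y \<bullet> (transpose_mat N * N *\<^sub>v y)"
      using N y transpose_vec_mult_scalar[of "transpose_mat N" n n "N *\<^sub>v y" y] by simp
    also have "\<dots> \<le> a * (y \<bullet> y)" using a y by blast
    finally have xy: "x \<bullet> x \<le> a * (y \<bullet> y)" .
    \<comment> \<open>Cauchy--Schwarz for the form \<open>T\<close>, obtained by evaluating it at \<open>x - y / c\<close>.\<close>
    have "x \<bullet> (T *\<^sub>v y) = y \<bullet> y"
      using T x y sym transpose_vec_mult_scalar[of T n n y x] by (simp add: y_def)
    then have *: "(x - (1 / c) \<cdot>\<^sub>v y) \<bullet> (T *\<^sub>v (x - (1 / c) \<cdot>\<^sub>v y))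
        = x \<bullet> y - 2 / c * (y \<bullet> y) + (1 / c)\<^sup>2 * (y \<bullet> (T *\<^sub>v y))"
      using T x y Ty
      by (simp add: mult_minus_distrib_mat_vec[of T n n] mult_mat_vec[of T n n] y_def[symmetric]
          minus_scalar_prod_distrib[of _ n] scalar_prod_minus_distrib[of _ n]
          power2_eq_square algebra_simps)
    have **: "0 \<le> (x - (1 / c) \<cdot>\<^sub>v y) \<bullet> (T *\<^sub>v (x - (1 / c) \<cdot>\<^sub>v y))"
      using x y by (intro psd) auto
    have ***: "(1 / c)\<^sup>2 * (y \<bullet> (T *\<^sub>v y)) \<le> (1 / c)\<^sup>2 * (c * (y \<bullet> y))"
      using c y by (intro mult_left_mono) auto
    have "y \<bullet> y / c \<le> x \<bullet> y"
    proof -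
      have "(1 / c)\<^sup>2 * (c * (y \<bullet> y)) = y \<bullet> y / c"
        using c(1) by (simp add: power2_eq_square)
      then show ?thesis
        using * ** *** by simp
    qed
    moreover have "1 / (a * c) * (x \<bullet> x) \<le> y \<bullet> y / c"
      using xy a c by (simp add: field_simps)
    ultimately show "1 / (a * c) * (x \<bullet> x) \<le> x \<bullet> (T *\<^sub>v x)"
      unfolding y_def by linarith
  qed
qed

text \<open>The supremum \<open>s\<close> of the Rayleigh quotient is an eigenvalue: otherwise \<open>s - S\<close> would be
  nonsingular and hence coercive, and \<open>s\<close> could be lowered. No compactness is needed.\<close>

lemma spectrum_ge_Rayleigh_quotient:
  fixes S :: "real mat"
  assumes S: "S \<in> carrier_mat n n" and sym: "transpose_mat S = S"
    and x: "x \<in> carrier_vec n" "x \<noteq> 0\<^sub>v n"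
  obtains e where "e \<in> spectrum S" "x \<bullet> (S *\<^sub>v x) \<le> e * (x \<bullet> x)"
proof
  define Q where "Q = (\<lambda>v. v \<bullet> (S *\<^sub>v v) / (v \<bullet> v)) ` (carrier_vec n - {0\<^sub>v n})"
  have pos: "0 < v \<bullet> v" if "v \<in> carrier_vec n" "v \<noteq> 0\<^sub>v n" for v :: "real Matrix.vec"
    using scalar_prod_self_ge_0[of v] scalar_prod_self_eq_0_iff[OF that(1)] that(2) by linarith
  obtain c where c: "\<And>v. v \<in> carrier_vec n \<Longrightarrow> v \<bullet> (S *\<^sub>v v) \<le> c * (v \<bullet> v)"
    using quadratic_form_bound[OF S] by metis
  have bdd: "bdd_above Q"
    unfolding Q_def using c pos by (intro bdd_aboveI2[of _ _ c]) (auto simp: pos_divide_le_eq)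
  have ne: "Q \<noteq> {}"
    using x by (auto simp: Q_def)
  have le_Sup: "v \<bullet> (S *\<^sub>v v) \<le> Sup Q * (v \<bullet> v)" if "v \<in> carrier_vec n" for v
  proof (cases "v = 0\<^sub>v n")
    case True
    then show ?thesis using S by simp
  next
    case False
    then have "v \<bullet> (S *\<^sub>v v) / (v \<bullet> v) \<le> Sup Q"
      using that bdd by (intro cSup_upper) (auto simp: Q_def)
    then show ?thesis using pos[OF that False] by (simp add: pos_divide_le_eq)
  qed
  show "x \<bullet> (S *\<^sub>v x) \<le> Sup Q * (x \<bullet> x)"
    using x by (intro le_Sup)
  define T where "T = Sup Q \<cdot>\<^sub>m 1\<^sub>m n - S"
  have T: "T \<in> carrier_mat n n"
    using S by (simp add: T_def minus_carrier_mat)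
  have smult_one: "(k \<cdot>\<^sub>m 1\<^sub>m n) *\<^sub>v v = k \<cdot>\<^sub>v v" if "v \<in> carrier_vec n" for k :: real and v
    using that by (intro eq_vecI) auto
  have Tv: "T *\<^sub>v v = Sup Q \<cdot>\<^sub>v v - S *\<^sub>v v" if "v \<in> carrier_vec n" for v
    using S that by (simp add: T_def minus_mult_distrib_mat_vec[of _ n n] smult_one)
  have form: "v \<bullet> (T *\<^sub>v v) = Sup Q * (v \<bullet> v) - v \<bullet> (S *\<^sub>v v)" if "v \<in> carrier_vec n" for v
    using S that by (simp add: Tv scalar_prod_minus_distrib[of _ n])
  have Tsym: "transpose_mat T = T"
    using S symmetric_mat_index[OF S sym] by (intro eq_matI) (auto simp: T_def)
  have "det T = 0"
  proof (rule ccontr)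
    assume "det T \<noteq> 0"
    then obtain d where d: "0 < d" "\<And>v. v \<in> carrier_vec n \<Longrightarrow> d * (v \<bullet> v) \<le> v \<bullet> (T *\<^sub>v v)"
      using psd_nonsingular_coercive[OF T Tsym] form le_Sup by (metis diff_ge_0_iff_ge)
    have "Sup Q \<le> Sup Q - d"
    proof (rule cSup_least[OF ne])
      fix q assume "q \<in> Q"
      then obtain v where v: "v \<in> carrier_vec n" "v \<noteq> 0\<^sub>v n" "q = v \<bullet> (S *\<^sub>v v) / (v \<bullet> v)"
        by (auto simp: Q_def)
      have "v \<bullet> (S *\<^sub>v v) \<le> (Sup Q - d) * (v \<bullet> v)"
        using d(2)[OF v(1)] form[OF v(1)] by (simp add: left_diff_distrib)
      then show "q \<le> Sup Q - d"
        using v pos by (simp add: pos_divide_le_eq)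
    qed
    then show False using d(1) by simp
  qed
  then obtain v where v: "v \<in> carrier_vec n" "v \<noteq> 0\<^sub>v n" "T *\<^sub>v v = 0\<^sub>v n"
    using det_0_iff_vec_prod_zero_field[OF T] by auto
  have "S *\<^sub>v v = Sup Q \<cdot>\<^sub>v v"
  proof (rule eq_vecI)
    fix i assume "i < dim_vec (Sup Q \<cdot>\<^sub>v v)"
    then have "i < n" using v by simp
    have "(Sup Q \<cdot>\<^sub>v v - S *\<^sub>v v) $ i = 0\<^sub>v n $ i"
      using v by (metis Tv)
    then show "(S *\<^sub>v v) $ i = (Sup Q \<cdot>\<^sub>v v) $ i"
      using \<open>i < n\<close> v S by simp
  qed (use S v in simp)
  then show "Sup Q \<in> spectrum S"
    using S v by (auto simp: spectrum_def eigenvalue_def eigenvector_def)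
qed

section \<open>Lower bounds for the largest singular value\<close>

lemma Cauchy_Schwarz_scalar_prod:
  fixes u v :: "real Matrix.vec"
  assumes "dim_vec u = dim_vec v"
  shows "(u \<bullet> v)\<^sup>2 \<le> (u \<bullet> u) * (v \<bullet> v)"
  using Cauchy_Schwarz_ineq_sum[of "vec_index u" "vec_index v" "{0..<dim_vec v}"] assms
  by (simp add: scalar_prod_def power2_eq_square)

text \<open>The form of \<open>M^T M\<close> at \<open>v\<close> is the squared length of
  \<open>M v\<close>, which Cauchy-Schwarz bounds from below through \<open>u\<close>. The Rayleigh
  bound then yields an eigenvalue of \<open>M^T M\<close> that is at least the square of the
  left-hand side.\<close>

lemma largest_singular_value_ge:
  fixes M :: "real mat"
  assumes M: "M \<in> carrier_mat m n" and u: "u \<in> carrier_vec m" "u \<noteq> 0\<^sub>v m"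
    and v: "v \<in> carrier_vec n" "v \<noteq> 0\<^sub>v n"
  shows "\<bar>u \<bullet> (M *\<^sub>v v)\<bar> / sqrt ((u \<bullet> u) * (v \<bullet> v)) \<le> largest_singular_value M"
proof -
  let ?S = "transpose_mat M * M"
  have S: "?S \<in> carrier_mat n n" using M by simp
  have "transpose_mat ?S = ?S" using M by (simp add: transpose_mult[of _ n m _ n])
  then obtain e where e: "e \<in> spectrum ?S" "v \<bullet> (?S *\<^sub>v v) \<le> e * (v \<bullet> v)"
    using spectrum_ge_Rayleigh_quotient[OF S _ v] by blast
  have pos: "0 < u \<bullet> u" "0 < v \<bullet> v"
    using scalar_prod_self_ge_0[of u] scalar_prod_self_ge_0[of v]
      scalar_prod_self_eq_0_iff[OF u(1)] scalar_prod_self_eq_0_iff[OF v(1)] u v by linarith+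
  have Mv: "M *\<^sub>v v \<in> carrier_vec m" using M v by simp
  have "(u \<bullet> (M *\<^sub>v v))\<^sup>2 \<le> (u \<bullet> u) * ((M *\<^sub>v v) \<bullet> (M *\<^sub>v v))"
    using u M by (intro Cauchy_Schwarz_scalar_prod) simp
  also have "(M *\<^sub>v v) \<bullet> (M *\<^sub>v v) = v \<bullet> (?S *\<^sub>v v)"
    using M v Mv transpose_vec_mult_scalar[of "transpose_mat M" n m "M *\<^sub>v v" v] by simp
  also have "(u \<bullet> u) * (v \<bullet> (?S *\<^sub>v v)) \<le> (u \<bullet> u) * (e * (v \<bullet> v))"
    using e pos by (intro mult_left_mono) auto
  finally have "(u \<bullet> (M *\<^sub>v v))\<^sup>2 / ((u \<bullet> u) * (v \<bullet> v)) \<le> e"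
    using pos by (simp add: pos_divide_le_eq mult_ac)
  then have "sqrt ((u \<bullet> (M *\<^sub>v v))\<^sup>2 / ((u \<bullet> u) * (v \<bullet> v))) \<le> sqrt e"
    by (rule real_sqrt_le_mono)
  then have "\<bar>u \<bullet> (M *\<^sub>v v)\<bar> / sqrt ((u \<bullet> u) * (v \<bullet> v)) \<le> sqrt e"
    by (simp add: real_sqrt_divide)
  also have "\<dots> \<le> largest_singular_value M"
    unfolding largest_singular_value_def singular_values_def
    using e card_finite_spectrum(1)[OF S] by (intro Max_ge) auto
  finally show ?thesis .
qed

text \<open>The test vectors are the indicators of \<open>I\<close> and \<open>J\<close>, whose
  squared lengths are the cardinalities.\<close>

lemma largest_singular_value_ge_block:
  fixes M :: "real mat"
  assumes M: "M \<in> carrier_mat n n" and I: "I \<subseteq> {..<n}" "I \<noteq> {}" and J: "J \<subseteq> {..<n}" "J \<noteq> {}"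
  shows "\<bar>\<Sum>i\<in>I. \<Sum>j\<in>J. M $$ (i, j)\<bar> / sqrt (real (card I) * real (card J)) \<le> largest_singular_value M"
proof -
  define e where "e = (\<lambda>I :: nat set. Matrix.vec n (indicator I :: nat \<Rightarrow> real))"
  have e: "e I \<in> carrier_vec n" for I
    by (simp add: e_def)
  have restrict: "(\<Sum>i = 0..<n. indicator I i * f i) = (\<Sum>i\<in>I. f i)"
    if "I \<subseteq> {..<n}" for I and f :: "nat \<Rightarrow> real"
    using that by (subst sum_indicator_mult) (auto intro!: sum.cong)
  have self: "e I \<bullet> e I = real (card I)" if "I \<subseteq> {..<n}" for I
    using restrict[OF that, of "indicator I"] by (simp add: e_def scalar_prod_def)
  have nz: "e I \<noteq> 0\<^sub>v n" if I: "I \<subseteq> {..<n}" "I \<noteq> {}" for I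
  proof -
    have "finite I" using I finite_subset by blast
    then show ?thesis
      using self[OF I(1)] scalar_prod_self_eq_0_iff[OF e, of I] I by auto
  qed
  have "(M *\<^sub>v e J) $ i = (\<Sum>j\<in>J. M $$ (i, j))" if "i < n" for i
    using restrict[OF J(1), of "\<lambda>j. M $$ (i, j)"] M that
    by (simp add: e_def scalar_prod_def mult.commute)
  then have "e I \<bullet> (M *\<^sub>v e J) = (\<Sum>i\<in>I. \<Sum>j\<in>J. M $$ (i, j))"
    using restrict[OF I(1), of "\<lambda>i. (M *\<^sub>v e J) $ i"] M I(1)
    by (simp add: scalar_prod_def e_def subset_iff)
  then show ?thesis
    using largest_singular_value_ge[OF M e nz[OF I] e nz[OF J]] self I J by simp
qed

section \<open>Block averages\<close>

text \<open>Pairs are ordered, and the sets may overlap. With this index set the two cases of the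
  plug-in estimate become one average, and the zero diagonal of the adjacency matrix stays out of
  it.\<close>

definition off_diagonal :: "'a set \<Rightarrow> 'a set \<Rightarrow> ('a \<times> 'a) set" where
  "off_diagonal I J = {(i, j). i \<in> I \<and> j \<in> J \<and> i \<noteq> j}"

lemma off_diagonal_eq_Times: "I \<inter> J = {} \<Longrightarrow> off_diagonal I J = I \<times> J"
  by (auto simp: off_diagonal_def)

lemma finite_off_diagonal [simp]: "finite I \<Longrightarrow> finite J \<Longrightarrow> finite (off_diagonal I J)"
  by (rule finite_subset[of _ "I \<times> J"]) (auto simp: off_diagonal_def)

lemma card_off_diagonal:
  assumes "finite I" "finite J"
  shows "card (off_diagonal I J) + card (I \<inter> J) = card I * card J"
proof -
  have "I \<times> J = off_diagonal I J \<union> (\<lambda>i. (i, i)) ` (I \<inter> J)"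
    by (auto simp: off_diagonal_def)
  moreover have "off_diagonal I J \<inter> (\<lambda>i. (i, i)) ` (I \<inter> J) = {}"
    by (auto simp: off_diagonal_def)
  ultimately have "card (I \<times> J) = card (off_diagonal I J) + card ((\<lambda>i. (i, i)) ` (I \<inter> J))"
    using assms by (simp add: card_Un_disjoint)
  then show ?thesis
    by (simp add: card_image inj_on_def card_cartesian_product)
qed

text \<open>The missing diagonal has \<open>card (I \<inter> J)\<close> elements, which is at most
  each of the two cardinalities and hence at most their geometric mean. The loss is therefore of
  lower order than the block size.\<close>

lemma card_off_diagonal_ge:
  assumes "finite I" "finite J"
  shows "real (card I) * real (card J) - sqrt (real (card I) * real (card J))
           \<le> real (card (off_diagonal I J))"
proof -
  have "card (I \<inter> J) * card (I \<inter> J) \<le> card I * card J"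
    using assms by (intro mult_le_mono card_mono) auto
  then have "(real (card (I \<inter> J)))\<^sup>2 \<le> real (card I) * real (card J)"
    by (metis of_nat_le_iff of_nat_mult power2_eq_square)
  then have "real (card (I \<inter> J)) \<le> sqrt (real (card I) * real (card J))"
    by (rule real_le_rsqrt)
  moreover have "real (card (off_diagonal I J)) + real (card (I \<inter> J)) = real (card I) * real (card J)"
    using card_off_diagonal[OF assms] by (metis of_nat_add of_nat_mult)
  ultimately show ?thesis by linarith
qed

section \<open>Block sums over unordered node pairs\<close>

definition node_pairs :: "nat \<Rightarrow> (nat \<times> nat) set" where
  "node_pairs n = {(i, j). i < j \<and> j < n}"

lemma finite_node_pairs [simp]: "finite (node_pairs n)"
  by (rule finite_subset[of _ "{..<n} \<times> {..<n}"]) (auto simp: node_pairs_def)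

text \<open>How often an unordered pair of nodes occurs in the block \<open>I \<times> J\<close>; the blocks may overlap.\<close>

definition block_count :: "nat set \<Rightarrow> nat set \<Rightarrow> nat \<times> nat \<Rightarrow> real" where
  "block_count I J = (\<lambda>(i, j). of_bool (i \<in> I \<and> j \<in> J) + of_bool (j \<in> I \<and> i \<in> J))"

text \<open>Pairs below the diagonal are reflected to the other side. This rewrites a block sum in
  terms of the entries with \<open>i < j\<close>, the ones that are independent in the
  model.\<close>

lemma sum_off_diagonal_symmetric:
  fixes f :: "nat \<times> nat \<Rightarrow> real"
  assumes I: "I \<subseteq> {..<n}" and J: "J \<subseteq> {..<n}"
    and sym: "\<And>i j. i < n \<Longrightarrow> j < n \<Longrightarrow> f (j, i) = f (i, j)"
  shows "sum f (off_diagonal I J) = (\<Sum>e\<in>node_pairs n. block_count I J e * f e)"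
proof -
  let ?U = "{(i, j) \<in> node_pairs n. i \<in> I \<and> j \<in> J}"
  let ?V = "{(i, j) \<in> node_pairs n. j \<in> I \<and> i \<in> J}"
  have fin: "finite ?U" "finite ?V"
    by (rule finite_subset[OF _ finite_node_pairs[of n]], auto)+
  have "off_diagonal I J = ?U \<union> prod.swap ` ?V"
    using I J by (auto simp: off_diagonal_def node_pairs_def image_iff)
  moreover have "?U \<inter> prod.swap ` ?V = {}"
    by (auto simp: node_pairs_def)
  ultimately have "sum f (off_diagonal I J) = sum f ?U + sum f (prod.swap ` ?V)"
    using fin by (simp add: sum.union_disjoint)
  also have "sum f (prod.swap ` ?V) = sum (f \<circ> prod.swap) ?V"
    by (intro sum.reindex) (auto simp: inj_on_def)
  also have "\<dots> = sum f ?V"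
    using sym by (intro sum.cong) (auto simp: node_pairs_def)
  also have "sum f ?U = (\<Sum>e\<in>node_pairs n. of_bool (fst e \<in> I \<and> snd e \<in> J) * f e)"
    by (intro sum.mono_neutral_cong_left) auto
  also have "sum f ?V = (\<Sum>e\<in>node_pairs n. of_bool (snd e \<in> I \<and> fst e \<in> J) * f e)"
    by (intro sum.mono_neutral_cong_left) auto
  finally show ?thesis
    by (simp add: block_count_def case_prod_beta distrib_right sum.distrib)
qed

section \<open>Plug-in averages and the rescaled matrix\<close>

lemma adjacency_matrix_symmetric:
  assumes "A \<in> adjacency_matrices n" "i < n" "j < n"
  shows "A $$ (j, i) = A $$ (i, j)"
  using assms symmetric_mat_index[of A n i j] by (auto simp: adjacency_matrices_def)

lemma adjacency_matrix_entry:
  assumes "A \<in> adjacency_matrices n" "e \<in> node_pairs n"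
  shows "A $$ e \<in> {0, 1}"
proof (cases e)
  case (Pair i j)
  then have "i < n" "j < n" using assms(2) by (auto simp: node_pairs_def)
  then show ?thesis using Pair assms(1) by (auto simp: adjacency_matrices_def)
qed

lemma community_subset: "community n h k \<subseteq> {..<n}"
  by (auto simp: community_def)

lemma finite_community [simp]: "finite (community n h k)"
  by (simp add: community_def)

text \<open>The factor 2 in the diagonal case accounts for each unordered pair being listed in both
  orders. If the block has no off-diagonal pair, both sides are 0 by the convention for division by
  0.\<close>

lemma plugin_B_eq_average:
  assumes A: "A \<in> adjacency_matrices n" and k: "k < K0" and l: "l < K0"
  shows "plugin_B n K0 A h $$ (k, l) =
    (\<Sum>e\<in>off_diagonal (community n h k) (community n h l). A $$ e)
      / real (card (off_diagonal (community n h k) (community n h l)))"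
proof (cases "k = l")
  case False
  then have "community n h k \<inter> community n h l = {}"
    by (auto simp: community_def)
  then show ?thesis
    using False k l
    by (simp add: plugin_B_def Let_def off_diagonal_eq_Times card_cartesian_product
        sum.cartesian_product case_prod_unfold)
next
  case True
  define N where "N = community n h k"
  have "(\<Sum>e\<in>off_diagonal N N. A $$ e) = (\<Sum>e\<in>node_pairs n. block_count N N e * A $$ e)"
    using A community_subset[of n h k] unfolding N_def
    by (intro sum_off_diagonal_symmetric) (auto simp: adjacency_matrix_symmetric)
  also have "\<dots> = (\<Sum>e\<in>{(i, j). i \<in> N \<and> j \<in> N \<and> i < j}. 2 * A $$ e)"
    by (intro sum.mono_neutral_cong_right finite_node_pairs)
      (auto simp: N_def block_count_def node_pairs_def community_def of_bool_def split: if_splits)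
  finally have sum: "(\<Sum>e\<in>off_diagonal N N. A $$ e) =
      2 * (\<Sum>(i, j)\<in>{(i, j). i \<in> N \<and> j \<in> N \<and> i < j}. A $$ (i, j))"
    by (simp add: sum_distrib_left case_prod_unfold)
  have "real (card (off_diagonal N N)) = real (card N) * (real (card N) - 1)"
    using arg_cong[OF card_off_diagonal[of N N], of real] by (simp add: N_def algebra_simps)
  then show ?thesis
    using True k l sum by (simp add: plugin_B_def Let_def N_def)
qed

text \<open>An average of 0/1 values can be 0 or 1 only if all values agree with it. This is what
  makes the convention 0/0 = 0 harmless for degenerate plug-in estimates.\<close>

lemma zero_one_average:
  fixes f :: "'a \<Rightarrow> real"
  assumes fin: "finite S" "S \<noteq> {}" and f: "\<And>x. x \<in> S \<Longrightarrow> f x \<in> {0, 1}"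
  shows "0 \<le> sum f S / real (card S)" and "sum f S / real (card S) \<le> 1"
    and "sum f S / real (card S) \<in> {0, 1} \<Longrightarrow> x \<in> S \<Longrightarrow> f x = sum f S / real (card S)"
proof -
  have card: "0 < real (card S)" using fin by (simp add: card_gt_0_iff)
  have nonneg: "0 \<le> f x" "f x \<le> 1" if "x \<in> S" for x using f[OF that] by auto
  show "0 \<le> sum f S / real (card S)"
    using nonneg by (intro divide_nonneg_nonneg sum_nonneg) auto
  have "sum f S \<le> real (card S)"
    using sum_mono[of S f "\<lambda>_. 1"] nonneg by simp
  then show "sum f S / real (card S) \<le> 1"
    using card by simp
  assume "sum f S / real (card S) \<in> {0, 1}" and x: "x \<in> S"
  then consider "sum f S = 0" | "sum f S = real (card S)"
    using card by auto
  then show "f x = sum f S / real (card S)"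
  proof cases
    case 1
    then show ?thesis
      using x nonneg fin by (simp add: sum_nonneg_eq_0_iff)
  next
    case 2
    then have "(\<Sum>x\<in>S. 1 - f x) = 0"
      by (simp add: sum_subtractf)
    then show ?thesis
      using x nonneg fin 2 card by (subst (asm) sum_nonneg_eq_0_iff) auto
  qed
qed

text \<open>On the block the estimate is one constant \<open>p\<close>, so the rescaled sum is the
  centered sum \<open>D\<close> divided by a single scale \<open>s\<close>. Since
  \<open>p * (1 - p) \<le> 1 / 4\<close>, that scale is at most \<open>sqrt n / 2\<close>.\<close>

lemma rescaled_block_sum_ge:
  assumes n: "2 \<le> n" and A: "A \<in> adjacency_matrices n" and k: "k < K0" and l: "l < K0"
    and I: "I \<subseteq> community n h k" and J: "J \<subseteq> community n h l"
  shows "2 / sqrt (real n) * \<bar>\<Sum>e\<in>off_diagonal I J. A $$ e - plugin_B n K0 A h $$ (k, l)\<bar>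
    \<le> \<bar>\<Sum>i\<in>I. \<Sum>j\<in>J. rescaled_adjacency n K0 A h $$ (i, j)\<bar>"
proof -
  define p where "p = plugin_B n K0 A h $$ (k, l)"
  define s where "s = sqrt (real (n - 1) * p * (1 - p))"
  define D where "D = (\<Sum>e\<in>off_diagonal I J. A $$ e - p)"
  let ?O = "off_diagonal (community n h k) (community n h l)"
  have fin: "finite I" "finite J"
    using I J finite_subset finite_community by blast+
  have sub: "off_diagonal I J \<subseteq> ?O"
    using I J by (auto simp: off_diagonal_def)
  have A01: "A $$ e \<in> {0, 1}" if "e \<in> ?O" for e
    using that A by (auto simp: off_diagonal_def community_def adjacency_matrices_def)
  have "(\<Sum>i\<in>I. \<Sum>j\<in>J. rescaled_adjacency n K0 A h $$ (i, j))
      = (\<Sum>e\<in>I \<times> J. rescaled_adjacency n K0 A h $$ e)"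
    by (simp add: sum.cartesian_product case_prod_unfold)
  \<comment> \<open>Diagonal positions contribute nothing because the rescaled matrix is 0
    there.\<close>
  also have "\<dots> = (\<Sum>e\<in>off_diagonal I J. (A $$ e - p) / s)"
    using I J fin
    by (intro sum.mono_neutral_cong_right)
      (auto simp: off_diagonal_def rescaled_adjacency_def plugin_P_def Let_def p_def s_def
        community_def subset_iff)
  also have "\<dots> = D / s"
    by (simp add: D_def sum_divide_distrib)
  finally have block: "(\<Sum>i\<in>I. \<Sum>j\<in>J. rescaled_adjacency n K0 A h $$ (i, j)) = D / s" .
  have "2 / sqrt (real n) * \<bar>D\<bar> \<le> \<bar>D / s\<bar>"
  proof (cases "D = 0")
    case False
    then have "off_diagonal I J \<noteq> {}"
      by (auto simp: D_def)
    then have ne: "?O \<noteq> {}" using sub by auto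
    \<comment> \<open>As \<open>p\<close> averages over the whole estimated block,
      \<open>p = 0\<close> or \<open>p = 1\<close> would force every entry there to equal
      \<open>p\<close>, contradicting \<open>D \<noteq> 0\<close>. So the scale is positive.\<close>
    have p_avg: "p = (\<Sum>e\<in>?O. A $$ e) / real (card ?O)"
      unfolding p_def by (rule plugin_B_eq_average[OF A k l])
    have avg: "0 \<le> p" "p \<le> 1" "\<And>e. p \<in> {0, 1} \<Longrightarrow> e \<in> ?O \<Longrightarrow> A $$ e = p"
      unfolding p_avg using ne A01 by (intro zero_one_average; simp)+
    have "p \<noteq> 0" "p \<noteq> 1"
    proof -
      have "D = 0" if "p = 0 \<or> p = 1"
        unfolding D_def using avg(3) that sub by (intro sum.neutral) auto
      then show "p \<noteq> 0" "p \<noteq> 1" using False by auto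
    qed
    then have p: "0 < p" "p < 1"
      using avg(1,2) by auto
    then have pp: "0 < p * (1 - p)" by simp
    then have s_pos: "0 < s" using n by (simp add: s_def mult.assoc)
    have "0 \<le> (2 * p - 1)\<^sup>2" by simp
    then have "p * (1 - p) \<le> 1 / 4"
      by (simp add: power2_eq_square algebra_simps)
    then have "real (n - 1) * (p * (1 - p)) \<le> real n * (1 / 4)"
      using pp by (intro mult_mono) auto
    then have "s \<le> sqrt (real n * (1 / 4))"
      unfolding s_def by (intro real_sqrt_le_mono) (simp add: mult.assoc)
    also have "\<dots> = sqrt (real n) / 2"
      by (simp add: real_sqrt_divide)
    finally have "2 / sqrt (real n) \<le> 1 / s"
      using s_pos n by (simp add: field_simps)
    then have "2 / sqrt (real n) * \<bar>D\<bar> \<le> 1 / s * \<bar>D\<bar>"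
      by (intro mult_right_mono) auto
    then show ?thesis using s_pos by simp
  qed simp
  then show ?thesis
    by (simp add: block D_def p_def)
qed

section \<open>Concentration of the block sums\<close>

lemma sbm_prob_space: "stochastic_block_model M n K g B A \<Longrightarrow> prob_space M"
  by (simp add: stochastic_block_model_def)

lemma sbm_adjacency:
  "stochastic_block_model M n K g B A \<Longrightarrow> \<omega> \<in> space M \<Longrightarrow> A \<omega> \<in> adjacency_matrices n"
  by (simp add: stochastic_block_model_def)

lemma sbm_indep:
  assumes "stochastic_block_model M n K g B A"
  shows "prob_space.indep_vars M (\<lambda>_. borel) (\<lambda>e \<omega>. A \<omega> $$ e) (node_pairs n)"
  using assms by (simp add: stochastic_block_model_def node_pairs_def case_prod_unfold)

lemma sbm_entry_measurable:
  assumes "stochastic_block_model M n K g B A" "e \<in> node_pairs n"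
  shows "(\<lambda>\<omega>. A \<omega> $$ e) \<in> borel_measurable M"
proof -
  interpret prob_space M using assms(1) by (rule sbm_prob_space)
  show ?thesis
    using sbm_indep[OF assms(1)] assms(2) unfolding indep_vars_def by blast
qed

lemma sbm_expectation:
  assumes sbm: "stochastic_block_model M n K g B A" and ij: "(i, j) \<in> node_pairs n"
  shows "integral\<^sup>L M (\<lambda>\<omega>. A \<omega> $$ (i, j)) = B $$ (g i, g j)"
proof -
  interpret prob_space M using sbm by (rule sbm_prob_space)
  let ?E = "{\<omega> \<in> space M. A \<omega> $$ (i, j) = 1}"
  have "integral\<^sup>L M (\<lambda>\<omega>. A \<omega> $$ (i, j)) = integral\<^sup>L M (indicat_real ?E)"
    using adjacency_matrix_entry[OF sbm_adjacency[OF sbm] ij]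
    by (intro Bochner_Integration.integral_cong) (auto simp: indicator_def)
  also have "\<dots> = prob (?E \<inter> space M)"
    by simp
  also have "?E \<inter> space M = ?E" by auto
  finally show ?thesis
    using sbm ij by (auto simp: stochastic_block_model_def node_pairs_def)
qed

text \<open>Hoeffding's inequality is applied to the independent variables \<open>c e * A e\<close>
  with ranges \<open>[0, c e]\<close>. The counts satisfy \<open>c e \<in> {0, 1, 2}\<close>, so
  their squares sum to at most twice the block size \<open>m\<close>; the exponent
  \<open>2 * t^2 * m / (2 * m)\<close> is then \<open>t^2\<close>.\<close>

lemma sbm_block_deviation:
  assumes sbm: "stochastic_block_model M n K g B A" and I: "I \<subseteq> {..<n}" and J: "J \<subseteq> {..<n}"
    and pos: "0 < t" "I \<noteq> {}" "J \<noteq> {}"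
  shows "measure M {\<omega> \<in> space M. t * sqrt (real (card I) * real (card J))
      \<le> \<bar>\<Sum>(i, j)\<in>off_diagonal I J. A \<omega> $$ (i, j) - B $$ (g i, g j)\<bar>} \<le> 2 * exp (- t\<^sup>2)"
proof -
  interpret prob_space M using sbm by (rule sbm_prob_space)
  define c where "c = block_count I J"
  define m where "m = real (card I) * real (card J)"
  define X where "X = (\<lambda>e \<omega>. c e * A \<omega> $$ e)"
  define \<mu> where "\<mu> = (\<Sum>e\<in>node_pairs n. expectation (X e))"
  have IJ_finite: "finite I" "finite J"
    using I J finite_subset by blast+
  then have m: "0 < m" using pos by (simp add: m_def card_gt_0_iff)
  have c: "0 \<le> c e" "(c e)\<^sup>2 \<le> 2 * c e" for e
    by (auto simp: c_def block_count_def split: prod.splits)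
  have P_sym: "B $$ (g j, g i) = B $$ (g i, g j)" if "i < n" "j < n" for i j
    using sbm that by (intro symmetric_mat_index[of B K])
      (auto simp: stochastic_block_model_def labelling_def)
  interpret Hoeffding_ineq M "node_pairs n" X "\<lambda>_. 0" c \<mu>
  proof unfold_locales
    show "indep_vars (\<lambda>_. borel) X (node_pairs n)"
      unfolding X_def by (rule indep_vars_compose2[OF sbm_indep[OF sbm]]) auto
    show "AE \<omega> in M. X e \<omega> \<in> {0..c e}" if "e \<in> node_pairs n" for e
    proof (rule AE_I2)
      fix \<omega> assume "\<omega> \<in> space M"
      then have "A \<omega> $$ e \<in> {0, 1}"
        using sbm_adjacency[OF sbm] that by (intro adjacency_matrix_entry)
      then show "X e \<omega> \<in> {0..c e}"
        using c[of e] by (auto simp: X_def)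
    qed
  qed (simp_all add: \<mu>_def)
  have deviation: "(\<Sum>(i, j)\<in>off_diagonal I J. A \<omega> $$ (i, j) - B $$ (g i, g j))
      = (\<Sum>e\<in>node_pairs n. X e \<omega>) - \<mu>" if "\<omega> \<in> space M" for \<omega>
  proof -
    have mean: "expectation (X e) = c e * (case e of (i, j) \<Rightarrow> B $$ (g i, g j))" if "e \<in> node_pairs n" for e
      using sbm_expectation[OF sbm, of "fst e" "snd e"] that by (simp add: X_def case_prod_unfold)
    have "(\<Sum>(i, j)\<in>off_diagonal I J. A \<omega> $$ (i, j) - B $$ (g i, g j))
        = (\<Sum>e\<in>node_pairs n. c e * (case e of (i, j) \<Rightarrow> A \<omega> $$ (i, j) - B $$ (g i, g j)))"
      unfolding c_def
      using adjacency_matrix_symmetric[OF sbm_adjacency[OF sbm that]] P_sym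
      by (intro sum_off_diagonal_symmetric[OF I J]) auto
    also have "\<dots> = (\<Sum>e\<in>node_pairs n. X e \<omega> - expectation (X e))"
      by (intro sum.cong refl) (subst mean, simp_all add: X_def right_diff_distrib case_prod_unfold)
    finally show ?thesis
      by (simp add: \<mu>_def sum_subtractf)
  qed
  have "sum c (node_pairs n) = real (card (off_diagonal I J))"
    using sum_off_diagonal_symmetric[OF I J, of "\<lambda>_. 1"] by (simp add: c_def)
  also have "\<dots> \<le> m"
    using arg_cong[OF card_off_diagonal[OF IJ_finite], where f = real] by (simp add: m_def)
  finally have var: "(\<Sum>e\<in>node_pairs n. (c e)\<^sup>2) \<le> 2 * m"
    using sum_mono[of "node_pairs n" "\<lambda>e. (c e)\<^sup>2" "\<lambda>e. 2 * c e"] c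
    by (simp add: sum_distrib_left[symmetric])
  show ?thesis
  proof (cases "0 < (\<Sum>e\<in>node_pairs n. (c e)\<^sup>2)")
    case True
    have "prob {\<omega> \<in> space M. t * sqrt m \<le> \<bar>\<Sum>(i, j)\<in>off_diagonal I J. A \<omega> $$ (i, j) - B $$ (g i, g j)\<bar>}
        = prob {\<omega> \<in> space M. t * sqrt m \<le> \<bar>(\<Sum>e\<in>node_pairs n. X e \<omega>) - \<mu>\<bar>}"
      using deviation by (intro arg_cong[of _ _ prob]) auto
    also have "\<dots> \<le> 2 * exp (- 2 * (t * sqrt m)\<^sup>2 / (\<Sum>e\<in>node_pairs n. (c e)\<^sup>2))"
      using Hoeffding_ineq_abs_ge[of "t * sqrt m"] True m pos by simp
    also have "\<dots> \<le> 2 * exp (- t\<^sup>2)"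
    proof -
      have "t\<^sup>2 * (\<Sum>e\<in>node_pairs n. (c e)\<^sup>2) \<le> t\<^sup>2 * (2 * m)"
        using var by (intro mult_left_mono) auto
      then have "t\<^sup>2 \<le> 2 * (t * sqrt m)\<^sup>2 / (\<Sum>e\<in>node_pairs n. (c e)\<^sup>2)"
        using True m by (simp add: pos_le_divide_eq power_mult_distrib)
      then show ?thesis by simp
    qed
    finally show ?thesis by (simp add: m_def)
  next
    \<comment> \<open>All counts vanish, for instance when \<open>I\<close> and \<open>J\<close> are
      the same singleton. Hoeffding's inequality requires a positive sum of squares, but here the
      deviation is identically 0 and cannot reach the positive threshold.\<close>
    case False
    then have "\<forall>e\<in>node_pairs n. (c e)\<^sup>2 = 0"
      by (metis (no_types, lifting) finite_node_pairs order_less_le sum_nonneg sum_nonneg_eq_0_iff zero_le_power2)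
    then have zero: "(\<Sum>(i, j)\<in>off_diagonal I J. A \<omega> $$ (i, j) - B $$ (g i, g j)) = 0"
      if "\<omega> \<in> space M" for \<omega>
      using deviation[OF that] by (simp add: X_def \<mu>_def)
    have "0 < t * sqrt m"
      using m pos by simp
    then have "{\<omega> \<in> space M. t * sqrt m \<le> \<bar>\<Sum>(i, j)\<in>off_diagonal I J. A \<omega> $$ (i, j) - B $$ (g i, g j)\<bar>} = {}"
      using zero by auto
    then show ?thesis
      by (simp only: m_def measure_empty) simp
  qed
qed

text \<open>The blocks to be used depend on the data through the estimator, so one exceptional event
  must serve all pairs \<open>(I, J)\<close> at once. The union bound over at most
  \<open>4^n\<close> pairs costs a factor that a threshold of order \<open>sqrt n\<close>
  absorbs.\<close>

lemma sbm_uniform_block_deviation: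
  assumes sbm: "stochastic_block_model M n K g B A" and n: "1 \<le> n" and \<epsilon>: "0 < \<epsilon>"
  obtains E where "E \<in> sets M" "measure M E \<le> \<epsilon>"
    "\<And>\<omega> I J. \<lbrakk>\<omega> \<in> space M - E; I \<subseteq> {..<n}; I \<noteq> {}; J \<subseteq> {..<n}; J \<noteq> {}\<rbrakk> \<Longrightarrow>
      \<bar>\<Sum>(i, j)\<in>off_diagonal I J. A \<omega> $$ (i, j) - B $$ (g i, g j)\<bar>
        \<le> sqrt (2 + 2 / \<epsilon>) * sqrt (real n) * sqrt (real (card I) * real (card J))"
proof -
  interpret prob_space M using sbm by (rule sbm_prob_space)
  \<comment> \<open>In \<open>t^2 = (2 + 2 / \<epsilon>) * n\<close> the term \<open>2 * n\<close>
    cancels the number of pairs, at most \<open>exp 2 ^ n\<close>. What remains is at most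
    \<open>2 * exp (- 2 / \<epsilon>)\<close>, which is at most \<epsilon> by
    \<open>exp x \<ge> 1 + x\<close>.\<close>
  define t where "t = sqrt (2 + 2 / \<epsilon>) * sqrt (real n)"
  have t: "0 < t" "t\<^sup>2 = (2 + 2 / \<epsilon>) * real n"
    using \<epsilon> n by (simp_all add: t_def power_mult_distrib add_pos_pos)
  define S where "S = (Pow {..<n} - {{}}) \<times> (Pow {..<n} - {{}})"
  define D where "D = (\<lambda>(I, J). {\<omega> \<in> space M. t * sqrt (real (card I) * real (card J))
    \<le> \<bar>\<Sum>(i, j)\<in>off_diagonal I J. A \<omega> $$ (i, j) - B $$ (g i, g j)\<bar>})"
  have S: "finite S" "real (card S) \<le> exp 2 ^ n"
  proof -
    show "finite S" by (simp add: S_def)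
    have "card S \<le> card (Pow {..<n} \<times> Pow {..<n})"
      by (intro card_mono) (auto simp: S_def)
    also have "\<dots> = 4 ^ n"
      by (simp add: card_cartesian_product card_Pow power_mult_distrib[symmetric])
    finally have "real (card S) \<le> 4 ^ n"
      by (metis of_nat_le_iff of_nat_numeral of_nat_power)
    also have "(4 :: real) \<le> exp 2"
      using power_mono[OF exp_ge_add_one_self[of "1 :: real"], of 2] exp_double[of "1::real"] by simp
    then have "(4 :: real) ^ n \<le> exp 2 ^ n"
      by (rule power_mono) simp
    finally show "real (card S) \<le> exp 2 ^ n" .
  qed
  have entry [measurable]: "(\<lambda>\<omega>. A \<omega> $$ (i, j)) \<in> borel_measurable M" if "i < n" "j < n" "i \<noteq> j" for i j
  proof (cases "i < j")
    case True
    then show ?thesis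
      using that by (intro sbm_entry_measurable[OF sbm]) (auto simp: node_pairs_def)
  next
    case False
    then have "(\<lambda>\<omega>. A \<omega> $$ (j, i)) \<in> borel_measurable M"
      using that by (intro sbm_entry_measurable[OF sbm]) (auto simp: node_pairs_def)
    then show ?thesis
      using adjacency_matrix_symmetric[OF sbm_adjacency[OF sbm]] that
      by (subst measurable_cong[where g = "\<lambda>\<omega>. A \<omega> $$ (j, i)"]) auto
  qed
  have D_sets: "D x \<in> sets M" if x: "x \<in> S" for x
  proof -
    obtain I J where IJ: "x = (I, J)" "I \<subseteq> {..<n}" "J \<subseteq> {..<n}"
      using x by (auto simp: S_def)
    have "(\<lambda>\<omega>. \<Sum>(i, j)\<in>off_diagonal I J. A \<omega> $$ (i, j) - B $$ (g i, g j)) \<in> borel_measurable M"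
      using IJ entry by (intro borel_measurable_sum) (auto simp: off_diagonal_def subset_iff)
    then show ?thesis
      unfolding D_def IJ(1) by simp
  qed
  have "measure M (\<Union>x\<in>S. D x) \<le> (\<Sum>x\<in>S. measure M (D x))"
    using S D_sets by (intro finite_measure_subadditive_finite) auto
  also have "\<dots> \<le> (\<Sum>x\<in>S. 2 * exp (- t\<^sup>2))"
    using sbm_block_deviation[OF sbm _ _ t(1)] by (intro sum_mono) (auto simp: S_def D_def)
  also have "\<dots> \<le> exp 2 ^ n * (2 * exp (- t\<^sup>2))"
    using S(2) by (simp add: mult_right_mono)
  also have "\<dots> = 2 * exp (- (2 / \<epsilon> * real n))"
    by (simp add: t(2) exp_of_nat2_mult[symmetric] exp_add[symmetric] algebra_simps)
  also have "\<dots> \<le> 2 * exp (- (2 / \<epsilon>))"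
    using n \<epsilon> by (simp add: field_simps)
  also have "\<dots> \<le> \<epsilon>"
    using exp_ge_add_one_self[of "2 / \<epsilon>"] \<epsilon> by (simp add: exp_minus field_simps)
  finally have "measure M (\<Union>x\<in>S. D x) \<le> \<epsilon>" .
  moreover have "(\<Union>x\<in>S. D x) \<in> sets M"
    using S D_sets by auto
  moreover have "\<bar>\<Sum>(i, j)\<in>off_diagonal I J. A \<omega> $$ (i, j) - B $$ (g i, g j)\<bar>
        \<le> sqrt (2 + 2 / \<epsilon>) * sqrt (real n) * sqrt (real (card I) * real (card J))"
    if "\<omega> \<in> space M - (\<Union>x\<in>S. D x)" "I \<subseteq> {..<n}" "I \<noteq> {}" "J \<subseteq> {..<n}" "J \<noteq> {}" for \<omega> I J
  proof -
    have "(I, J) \<in> S" using that by (simp add: S_def)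
    then have "\<omega> \<notin> D (I, J)" using that by blast
    then show ?thesis using that by (simp add: D_def t_def)
  qed
  ultimately show ?thesis
    using that[of "\<Union>x\<in>S. D x"] by blast
qed

section \<open>Measurability of functions of the random adjacency matrix\<close>

lemma finite_adjacency_matrices: "finite (adjacency_matrices n)"
proof (rule finite_subset)
  show "adjacency_matrices n \<subseteq> (\<lambda>E. Matrix.mat n n (indicator E)) ` Pow ({..<n} \<times> {..<n})"
  proof
    fix X assume X: "X \<in> adjacency_matrices n"
    have "X = Matrix.mat n n (indicator {(i, j). i < n \<and> j < n \<and> X $$ (i, j) = 1})"
      using X by (intro eq_matI) (force simp: adjacency_matrices_def indicator_def)+
    then show "X \<in> (\<lambda>E. Matrix.mat n n (indicator E)) ` Pow ({..<n} \<times> {..<n})"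
      by (rule image_eqI) auto
  qed
qed simp

lemma adjacency_matrix_eqI:
  assumes A: "A \<in> adjacency_matrices n" and X: "X \<in> adjacency_matrices n"
    and eq: "\<And>e. e \<in> node_pairs n \<Longrightarrow> A $$ e = X $$ e"
  shows "A = X"
proof (rule eq_matI)
  fix i j assume "i < dim_row X" "j < dim_col X"
  then have ij: "i < n" "j < n" using X by (auto simp: adjacency_matrices_def)
  consider "i < j" | "i = j" | "j < i" by linarith
  then show "A $$ (i, j) = X $$ (i, j)"
  proof cases
    case 1
    then show ?thesis using eq[of "(i, j)"] ij by (simp add: node_pairs_def)
  next
    case 2
    then show ?thesis using A X ij by (simp add: adjacency_matrices_def)
  next
    case 3
    then show ?thesis
      using eq[of "(j, i)"] ij adjacency_matrix_symmetric[OF A ij] adjacency_matrix_symmetric[OF X ij]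
      by (simp add: node_pairs_def)
  qed
qed (use A X in \<open>auto simp: adjacency_matrices_def\<close>)

text \<open>The matrix takes finitely many values, and each value is attained on a finite
  intersection of entry events. It is thus measurable into a discrete space, on which every function
  is measurable, including one built from an arbitrary estimator.\<close>

lemma sbm_measurable_function:
  fixes F :: "real mat \<Rightarrow> real"
  assumes sbm: "stochastic_block_model M n K g B A"
  shows "(\<lambda>\<omega>. F (A \<omega>)) \<in> borel_measurable M"
proof -
  have "A \<in> measurable M (count_space (adjacency_matrices n))"
    unfolding measurable_count_space_eq2[OF finite_adjacency_matrices]
  proof (intro conjI ballI Pi_I)
    fix X assume X: "X \<in> adjacency_matrices n"
    have "A -` {X} \<inter> space M = {\<omega> \<in> space M. \<forall>e\<in>node_pairs n. A \<omega> $$ e = X $$ e}"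
      using adjacency_matrix_eqI[OF sbm_adjacency[OF sbm] X] by auto
    also have "\<dots> \<in> sets M"
    proof (rule sets.sets_Collect_finite_All)
      show "{\<omega> \<in> space M. A \<omega> $$ e = X $$ e} \<in> sets M" if "e \<in> node_pairs n" for e
        using sbm_entry_measurable[OF sbm that] by measurable
    qed simp
    finally show "A -` {X} \<inter> space M \<in> sets M" .
  qed (use sbm_adjacency[OF sbm] in auto)
  then show ?thesis
    by (rule measurable_compose) simp
qed

section \<open>Merged communities\<close>

text \<open>The \<open>K0\<close> estimated communities cover \<open>N\<close>, so at least one of
  them captures the average share.\<close>

lemma exists_large_intersection:
  assumes h: "labelling n K0 h" and K0: "1 \<le> K0" and N: "N \<subseteq> {..<n}"
  obtains a where "a < K0" "real (card N) / real K0 \<le> real (card (N \<inter> community n h a))"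
proof -
  have "N = (\<Union>a<K0. N \<inter> community n h a)"
    using h N by (auto simp: labelling_def community_def)
  then have "card N = card (\<Union>a<K0. N \<inter> community n h a)"
    by (rule arg_cong)
  also have "\<dots> \<le> (\<Sum>a<K0. card (N \<inter> community n h a))"
    by (rule card_UN_le) simp
  finally have le: "real (card N) \<le> (\<Sum>a<K0. real (card (N \<inter> community n h a)))"
    by (metis of_nat_le_iff of_nat_sum)
  have "\<exists>a<K0. real (card N) / real K0 \<le> real (card (N \<inter> community n h a))"
  proof (rule ccontr)
    assume "\<not> ?thesis"
    then have "(\<Sum>a<K0. real (card (N \<inter> community n h a))) < (\<Sum>a<K0. real (card N) / real K0)"
      using K0 by (intro sum_strict_mono) (auto simp: not_le lessThan_empty_iff)
    then show False using le K0 by simp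
  qed
  then show ?thesis using that by blast
qed

text \<open>The map \<open>f\<close> sends each true community to an estimated one that holds a
  \<open>1 / K0\<close> share of it. It cannot be injective because \<open>K0 < K\<close>. The same
  inequality turns \<open>c0 * n / (K * K0)\<close> into the weaker bound with
  \<open>K^2\<close>.\<close>

lemma merged_communities:
  assumes h: "labelling n K0 h" and K0: "1 \<le> K0" "K0 < K" and "0 \<le> c0"
    and balanced: "\<And>k. k < K \<Longrightarrow> c0 * real n / real K \<le> real (card (community n g k))"
  obtains f k1 k2 where "\<And>k. k < K \<Longrightarrow> f k < K0"
    "\<And>k. k < K \<Longrightarrow> c0 * real n / (real K)\<^sup>2 \<le> real (card (community n g k \<inter> community n h (f k)))"
    "k1 < K" "k2 < K" "k1 \<noteq> k2" "f k1 = f k2"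
proof -
  have "\<exists>a<K0. real (card (community n g k)) / real K0 \<le> real (card (community n g k \<inter> community n h a))" for k
    using exists_large_intersection[OF h K0(1) community_subset[of n g k]] by blast
  then obtain f where f: "\<And>k. f k < K0"
    "\<And>k. real (card (community n g k)) / real K0 \<le> real (card (community n g k \<inter> community n h (f k)))"
    by metis
  have "card (f ` {..<K}) \<le> card {..<K0}"
    using f(1) by (intro card_mono) auto
  then have "\<not> inj_on f {..<K}"
    using K0 by (intro pigeonhole) simp
  then obtain k1 k2 where k: "k1 < K" "k2 < K" "k1 \<noteq> k2" "f k1 = f k2"
    by (auto simp: inj_on_def)
  have "c0 * real n / (real K)\<^sup>2 \<le> real (card (community n g k \<inter> community n h (f k)))" if "k < K" for k
  proof -
    have "c0 * real n / (real K)\<^sup>2 = c0 * real n / real K / real K"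
      by (simp add: power2_eq_square)
    also have "\<dots> \<le> real (card (community n g k)) / real K0"
      using balanced[OF that] K0 by (intro frac_le) auto
    finally show ?thesis using f(2)[of k] by linarith
  qed
  then show ?thesis using that f(1) k by blast
qed

section \<open>Row distances of the connectivity matrix\<close>

lemma finite_row_distances:
  "finite {linf_dist (Matrix.row B k) (Matrix.row B l) | k l. k < dim_row B \<and> l < dim_row B \<and> k \<noteq> l}"
  by (rule finite_subset[of _ "(\<lambda>(k, l). linf_dist (Matrix.row B k) (Matrix.row B l))
      ` ({..<dim_row B} \<times> {..<dim_row B})"]) auto

lemma min_row_dist_le:
  assumes B: "B \<in> carrier_mat K K" and kl: "k1 < K" "k2 < K" "k1 \<noteq> k2"
  obtains l where "l < K" "min_row_dist B \<le> \<bar>B $$ (k1, l) - B $$ (k2, l)\<bar>"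
proof -
  have "min_row_dist B \<le> linf_dist (Matrix.row B k1) (Matrix.row B k2)"
    unfolding min_row_dist_def using kl B finite_row_distances[of B] by (intro Min_le) auto
  moreover have "linf_dist (Matrix.row B k1) (Matrix.row B k2) = Max ((\<lambda>l. \<bar>B $$ (k1, l) - B $$ (k2, l)\<bar>) ` {..<K})"
    using B kl by (simp add: linf_dist_def)
  moreover have "\<dots> \<in> (\<lambda>l. \<bar>B $$ (k1, l) - B $$ (k2, l)\<bar>) ` {..<K}"
    using kl(1) by (intro Max_in) (auto simp: lessThan_empty_iff)
  ultimately show ?thesis using that by auto
qed

text \<open>With at least two rows the minimum ranges over a nonempty set and is attained as the
  distance of some pair.\<close>

lemma min_row_dist_nonneg:
  assumes B: "B \<in> carrier_mat K K" and K: "2 \<le> K"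
  shows "0 \<le> min_row_dist B"
proof -
  let ?S = "{linf_dist (Matrix.row B k) (Matrix.row B l) | k l. k < dim_row B \<and> l < dim_row B \<and> k \<noteq> l}"
  have "linf_dist (Matrix.row B 0) (Matrix.row B 1) \<in> ?S"
    by (rule CollectI, rule exI[of _ 0], rule exI[of _ 1]) (use B K in simp)
  then have "min_row_dist B \<in> ?S"
    unfolding min_row_dist_def using finite_row_distances[of B] by (intro Min_in) auto
  then obtain k l where kl: "min_row_dist B = linf_dist (Matrix.row B k) (Matrix.row B l)"
    by auto
  have "0 \<le> \<bar>Matrix.row B k $ 0 - Matrix.row B l $ 0\<bar>" by simp
  also have "\<dots> \<le> linf_dist (Matrix.row B k) (Matrix.row B l)"
    unfolding linf_dist_def using B K by (intro Max_ge) auto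
  finally show ?thesis using kl by simp
qed

section \<open>The deterministic lower bound\<close>

text \<open>This isolates what holds for every matrix whose block deviations are controlled by
  \<open>t\<close>. The half lost because \<open>p\<close> may lie midway between two means is
  regained from \<open>p * (1 - p) \<le> 1 / 4\<close>, so the main term has coefficient 1. Of the
  slack, \<open>2 * t\<close> pays for noise and 1 for the missing diagonal.\<close>

lemma largest_singular_value_rescaled_ge:
  assumes n: "2 \<le> n" and A: "A \<in> adjacency_matrices n" and B: "B \<in> connectivity_matrices K"
    and h: "labelling n K0 h" and K0: "1 \<le> K0" "K0 < K" and c0: "0 < c0"
    and balanced: "\<And>k. k < K \<Longrightarrow> c0 * real n / real K \<le> real (card (community n g k))"
    and deviation: "\<And>I J. \<lbrakk>I \<subseteq> {..<n}; I \<noteq> {}; J \<subseteq> {..<n}; J \<noteq> {}\<rbrakk> \<Longrightarrow>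
      \<bar>\<Sum>(i, j)\<in>off_diagonal I J. A $$ (i, j) - B $$ (g i, g j)\<bar>
        \<le> t * sqrt (real n) * sqrt (real (card I) * real (card J))"
  shows "min_row_dist B * c0 / (real K)\<^sup>2 * sqrt (real n) - (1 + 2 * t)
    \<le> largest_singular_value (rescaled_adjacency n K0 A h)"
proof -
  define \<delta> where "\<delta> = min_row_dist B"
  have Bc: "B \<in> carrier_mat K K"
    using B by (simp add: connectivity_matrices_def)
  obtain f k1 k2 where f: "\<And>k. k < K \<Longrightarrow> f k < K0"
    "\<And>k. k < K \<Longrightarrow> c0 * real n / (real K)\<^sup>2 \<le> real (card (community n g k \<inter> community n h (f k)))"
    and k12: "k1 < K" "k2 < K" "k1 \<noteq> k2" "f k1 = f k2"
    using merged_communities[OF h K0 less_imp_le[OF c0] balanced] by blast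
  obtain l where l: "l < K" "\<delta> \<le> \<bar>B $$ (k1, l) - B $$ (k2, l)\<bar>"
    using min_row_dist_le[OF Bc k12(1-3)] unfolding \<delta>_def by blast
  have "0 \<le> \<delta>"
    unfolding \<delta>_def using min_row_dist_nonneg[OF Bc] K0 by simp
  have "0 < B $$ (k, l) \<and> B $$ (k, l) < 1" if "k < K" for k
    using B l that by (simp add: connectivity_matrices_def)
  then have "\<delta> \<le> 1"
    using l k12 by (smt (verit))
  define p where "p = plugin_B n K0 A h $$ (f k1, f l)"
  \<comment> \<open>The estimate \<open>p\<close> is shared by the two merged communities, so it misses one of them.\<close>
  obtain k where k: "k < K" "f k = f k1" "\<delta> / 2 \<le> \<bar>B $$ (k, l) - p\<bar>"
  proof -
    have "\<delta> / 2 \<le> \<bar>B $$ (k1, l) - p\<bar> \<or> \<delta> / 2 \<le> \<bar>B $$ (k2, l) - p\<bar>"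
      using l by linarith
    then show ?thesis using that k12 by metis
  qed
  \<comment> \<open>On \<open>I \<times> J\<close> both the true mean \<open>B k l\<close> and the
    estimate \<open>p\<close> are constant: the first because of the true labels, the second because
    of the estimated ones.\<close>
  define I where "I = community n g k \<inter> community n h (f k1)"
  define J where "J = community n g l \<inter> community n h (f l)"
  define q where "q = c0 * real n / (real K)\<^sup>2"
  define r where "r = sqrt (real (card I) * real (card J))"
  have sub: "I \<subseteq> {..<n}" "J \<subseteq> {..<n}"
    by (auto simp: I_def J_def community_def)
  have fin: "finite I" "finite J"
    by (simp_all add: I_def J_def)
  have q: "0 < q" "q \<le> real (card I)" "q \<le> real (card J)"
    using c0 n K0 f(2)[OF k(1)] f(2)[OF l(1)] k(2) by (simp_all add: q_def I_def J_def)
  then have ne: "I \<noteq> {}" "J \<noteq> {}" by auto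
  have "q\<^sup>2 \<le> real (card I) * real (card J)"
    using q by (simp add: power2_eq_square mult_mono)
  then have "q \<le> r"
    unfolding r_def by (rule real_le_rsqrt)
  then have "0 < r" using q by linarith
  have r2: "r\<^sup>2 = real (card I) * real (card J)"
    by (simp add: r_def)
  \<comment> \<open>The centered sum is noise plus bias. The bias has one sign throughout the block,
    so it grows with the number of pairs, while the noise is only of order
    \<open>sqrt n * r\<close>.\<close>
  have split: "(\<Sum>e\<in>off_diagonal I J. A $$ e - p)
      = (\<Sum>(i, j)\<in>off_diagonal I J. A $$ (i, j) - B $$ (g i, g j))
        + real (card (off_diagonal I J)) * (B $$ (k, l) - p)"
  proof -
    have "(\<Sum>e\<in>off_diagonal I J. A $$ e - p)
        = (\<Sum>(i, j)\<in>off_diagonal I J. (A $$ (i, j) - B $$ (g i, g j)) + (B $$ (k, l) - p))"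
      by (intro sum.cong) (auto simp: off_diagonal_def I_def J_def community_def)
    then show ?thesis
      by (simp add: case_prod_unfold sum.distrib)
  qed
  have "\<delta> / 2 * (r\<^sup>2 - r) \<le> \<delta> / 2 * real (card (off_diagonal I J))"
    using card_off_diagonal_ge[OF fin] \<open>0 \<le> \<delta>\<close> unfolding r2 r_def by (intro mult_left_mono) auto
  also have "\<dots> \<le> \<bar>B $$ (k, l) - p\<bar> * real (card (off_diagonal I J))"
    using k(3) by (intro mult_right_mono) auto
  also have "\<dots> = \<bar>real (card (off_diagonal I J)) * (B $$ (k, l) - p)\<bar>"
    by (simp add: abs_mult)
  finally have "\<delta> / 2 * (r\<^sup>2 - r) - t * sqrt (real n) * r \<le> \<bar>\<Sum>e\<in>off_diagonal I J. A $$ e - p\<bar>"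
    using deviation[OF sub(1) ne(1) sub(2) ne(2)] unfolding split r_def[symmetric] by linarith
  then have "2 / sqrt (real n) * (\<delta> / 2 * (r\<^sup>2 - r) - t * sqrt (real n) * r)
      \<le> 2 / sqrt (real n) * \<bar>\<Sum>e\<in>off_diagonal I J. A $$ e - p\<bar>"
    by (intro mult_left_mono) auto
  also have "\<dots> \<le> \<bar>\<Sum>i\<in>I. \<Sum>j\<in>J. rescaled_adjacency n K0 A h $$ (i, j)\<bar>"
    unfolding p_def using f(1) k12 l
    by (intro rescaled_block_sum_ge[OF n A]) (auto simp: I_def J_def)
  also have "\<dots> \<le> largest_singular_value (rescaled_adjacency n K0 A h) * r"
    using largest_singular_value_ge_block[of "rescaled_adjacency n K0 A h" n I J] sub ne \<open>0 < r\<close>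
    unfolding r_def[symmetric] by (simp add: rescaled_adjacency_def pos_divide_le_eq)
  finally have "(\<delta> * (r - 1) / sqrt (real n) - 2 * t) * r
      \<le> largest_singular_value (rescaled_adjacency n K0 A h) * r"
    using n by (simp add: power2_eq_square field_simps)
  \<comment> \<open>Dividing by \<open>r\<close> undoes the normalization of the indicator
    vectors.\<close>
  then have main: "\<delta> * (r - 1) / sqrt (real n) - 2 * t
      \<le> largest_singular_value (rescaled_adjacency n K0 A h)"
    using \<open>0 < r\<close> by (simp add: mult_le_cancel_right)
  \<comment> \<open>It remains to replace \<open>r\<close> by its lower bound \<open>q\<close> and
    to absorb \<open>\<delta> / sqrt n\<close>, which is at most 1 because the entries of
    \<open>B\<close> lie in the unit interval.\<close>
  have "\<delta> * c0 / (real K)\<^sup>2 * sqrt (real n) = \<delta> * q / sqrt (real n)"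
    unfolding q_def by (subst real_div_sqrt[of "real n", symmetric]) simp_all
  also have "\<dots> \<le> \<delta> * r / sqrt (real n)"
    using \<open>q \<le> r\<close> \<open>0 \<le> \<delta>\<close> by (intro divide_right_mono mult_left_mono) auto
  also have "\<dots> = \<delta> * (r - 1) / sqrt (real n) + \<delta> / sqrt (real n)"
    by (simp add: diff_divide_distrib right_diff_distrib)
  finally have "\<delta> * c0 / (real K)\<^sup>2 * sqrt (real n) \<le> \<delta> * (r - 1) / sqrt (real n) + \<delta> / sqrt (real n)" .
  moreover have "\<delta> / sqrt (real n) \<le> 1 / 1"
    using \<open>\<delta> \<le> 1\<close> \<open>0 \<le> \<delta>\<close> n by (intro frac_le) auto
  ultimately show ?thesis
    using main by (simp add: \<delta>_def)
qed

section \<open>Stochastic boundedness of the remainder\<close>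

theorem theorem3p3:
  fixes M :: "nat \<Rightarrow> 'a measure"
    and K K0 :: "nat \<Rightarrow> nat"
    and g :: "nat \<Rightarrow> nat \<Rightarrow> nat"
    and B :: "nat \<Rightarrow> real mat"
    and A :: "nat \<Rightarrow> 'a \<Rightarrow> real mat"
    and ghat :: "nat \<Rightarrow> real mat \<Rightarrow> nat \<Rightarrow> nat \<Rightarrow> nat"
    and c0 :: real
  assumes sbm: "\<And>n. n \<ge> 1 \<Longrightarrow> stochastic_block_model (M n) n (K n) (g n) (B n) (A n)"
    and B: "\<And>n. n \<ge> 1 \<Longrightarrow> B n \<in> connectivity_matrices (K n)"
    and c0: "c0 > 0"
    and balanced: "\<And>n k. n \<ge> 1 \<Longrightarrow> k < K n \<Longrightarrow>
      real (card (community n (g n) k)) \<ge> c0 * real n / real (K n)"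
    and estimator: "\<And>n. n \<ge> 1 \<Longrightarrow> 1 \<le> K0 n \<Longrightarrow> K0 n < K n \<Longrightarrow>
      community_estimator n (K0 n) (ghat n)"
  shows "\<exists>R. O_P_1 M R \<and>
    (\<forall>n\<ge>1. 1 \<le> K0 n \<and> K0 n < K n \<longrightarrow>
      (\<forall>\<omega>\<in>space (M n).
        largest_singular_value
          (rescaled_adjacency n (K0 n) (A n \<omega>) (ghat n (A n \<omega>) (K0 n)))
        \<ge> 1 / 2 * min_row_dist (B n) * c0 / (real (K n))\<^sup>2 * sqrt (real n) + R n \<omega>))"
proof -
  define b where "b = (\<lambda>n. min_row_dist (B n) * c0 / (real (K n))\<^sup>2 * sqrt (real n))"
  define \<sigma> where "\<sigma> = (\<lambda>n X. largest_singular_value (rescaled_adjacency n (K0 n) X (ghat n X (K0 n))))"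
  \<comment> \<open>The remainder is \<sigma> minus half of \<open>b\<close>, cut off above at 0.
    The claimed inequality is then immediate, and only boundedness in probability needs proof. Where
    the condition on \<open>K0 n\<close> fails, the value 0 keeps the remainder bounded for every
    \<open>n\<close>.\<close>
  define F where "F = (\<lambda>n X. if 1 \<le> K0 n \<and> K0 n < K n then min 0 (\<sigma> n X - b n / 2) else 0)"
  have lower: "b n - (1 + 2 * t) \<le> \<sigma> n (A n \<omega>)"
    if n: "1 \<le> n" "1 \<le> K0 n" "K0 n < K n" and \<omega>: "\<omega> \<in> space (M n)"
      and deviation: "\<And>I J. \<lbrakk>I \<subseteq> {..<n}; I \<noteq> {}; J \<subseteq> {..<n}; J \<noteq> {}\<rbrakk> \<Longrightarrow>
        \<bar>\<Sum>(i, j)\<in>off_diagonal I J. A n \<omega> $$ (i, j) - B n $$ (g n i, g n j)\<bar>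
          \<le> t * sqrt (real n) * sqrt (real (card I) * real (card J))" for n t \<omega>
  proof -
    \<comment> \<open>Since \<open>K n\<close> is at least 2, two disjoint nonempty communities
      exist, which forces \<open>n \<ge> 2\<close>.\<close>
    have "community n (g n) k \<noteq> {}" if "k < K n" for k
      using balanced[OF n(1) that] c0 n by (auto simp: divide_le_0_iff mult_le_0_iff)
    from this[of 0] this[of 1] obtain i j where "i \<in> community n (g n) 0" "j \<in> community n (g n) 1"
      using n by auto
    then have "i < n" "j < n" "i \<noteq> j" by (auto simp: community_def)
    then have "2 \<le> n" by linarith
    have X: "A n \<omega> \<in> adjacency_matrices n"
      using sbm_adjacency[OF sbm \<omega>] n by simp
    then have "labelling n (K0 n) (ghat n (A n \<omega>) (K0 n))"
      using estimator n by (simp add: community_estimator_def)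
    then show ?thesis
      unfolding b_def \<sigma>_def
      using largest_singular_value_rescaled_ge[OF \<open>2 \<le> n\<close> X B[OF n(1)] _ n(2,3) c0 balanced[OF n(1)] deviation]
      by blast
  qed
  have b_nonneg: "0 \<le> b n" if "1 \<le> n" "1 \<le> K0 n" "K0 n < K n" for n
    using min_row_dist_nonneg[of "B n" "K n"] B[OF that(1)] that c0
    by (simp add: b_def connectivity_matrices_def)
  have "O_P_1 M (\<lambda>n \<omega>. F n (A n \<omega>))"
    unfolding O_P_1_def
  proof (intro conjI allI impI)
    show "(\<lambda>\<omega>. F n (A n \<omega>)) \<in> borel_measurable (M n)" if "1 \<le> n" for n
      using sbm[OF that] by (rule sbm_measurable_function)
    fix \<epsilon> :: real assume \<epsilon>: "0 < \<epsilon>"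
    \<comment> \<open>The constant depends on \<epsilon> alone, so a single bound
      \<open>1 + 2 * t\<close> serves all \<open>n\<close>.\<close>
    define t where "t = sqrt (2 + 2 / \<epsilon>)"
    have t: "0 \<le> t" using \<epsilon> by (simp add: t_def)
    have "measure (M n) {\<omega> \<in> space (M n). 1 + 2 * t < \<bar>F n (A n \<omega>)\<bar>} \<le> \<epsilon>" if n: "1 \<le> n" for n
    proof -
      interpret prob_space "M n" using sbm[OF n] by (rule sbm_prob_space)
      obtain E where E: "E \<in> sets (M n)" "measure (M n) E \<le> \<epsilon>"
        "\<And>\<omega> I J. \<lbrakk>\<omega> \<in> space (M n) - E; I \<subseteq> {..<n}; I \<noteq> {}; J \<subseteq> {..<n}; J \<noteq> {}\<rbrakk> \<Longrightarrow>
          \<bar>\<Sum>(i, j)\<in>off_diagonal I J. A n \<omega> $$ (i, j) - B n $$ (g n i, g n j)\<bar>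
            \<le> t * sqrt (real n) * sqrt (real (card I) * real (card J))"
        by (rule sbm_uniform_block_deviation[OF sbm[OF n] n \<epsilon>, folded t_def]) blast
      have "\<omega> \<in> E" if \<omega>: "\<omega> \<in> space (M n)" "1 + 2 * t < \<bar>F n (A n \<omega>)\<bar>" for \<omega>
      proof (rule ccontr)
        assume "\<omega> \<notin> E"
        have K0: "1 \<le> K0 n" "K0 n < K n"
          using \<omega>(2) t by (auto simp: F_def split: if_splits)
        have "b n - (1 + 2 * t) \<le> \<sigma> n (A n \<omega>)"
          using \<open>\<omega> \<notin> E\<close> \<omega>(1) by (intro lower[OF n K0 \<omega>(1)] E(3)) auto
        \<comment> \<open>Because \<open>b n \<ge> 0\<close>, subtracting only
          \<open>b n / 2\<close> from \<sigma> leaves at least \<open>- (1 + 2 * t)\<close>.\<close>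
        then have "\<bar>F n (A n \<omega>)\<bar> \<le> 1 + 2 * t"
          using b_nonneg[OF n K0] t by (auto simp: F_def)
        then show False using \<omega>(2) by simp
      qed
      then have "measure (M n) {\<omega> \<in> space (M n). 1 + 2 * t < \<bar>F n (A n \<omega>)\<bar>} \<le> measure (M n) E"
        using E(1) by (intro finite_measure_mono) auto
      then show ?thesis using E(2) by linarith
    qed
    then show "\<exists>C. \<forall>n\<ge>1. measure (M n) {\<omega> \<in> space (M n). C < \<bar>F n (A n \<omega>)\<bar>} \<le> \<epsilon>"
      by blast
  qed
  moreover have "1 / 2 * min_row_dist (B n) * c0 / (real (K n))\<^sup>2 * sqrt (real n) + F n (A n \<omega>) \<le> \<sigma> n (A n \<omega>)"
    if "1 \<le> K0 n \<and> K0 n < K n" for n \<omega>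
    using that by (auto simp: F_def b_def)
  ultimately show ?thesis
    unfolding \<sigma>_def by (intro exI[of _ "\<lambda>n \<omega>. F n (A n \<omega>)"]) auto
qed

end
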